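(* Let $0<\alpha<1$ and let $G=(V,E)$ be a connected graph on $n$ nodes with minimum degree $\delta$. Then $1\le MD_{\alpha}(G)\le \left(\frac{\delta+\frac{1}{\alpha}}{\delta+1}\right)\alpha n$.
   Context: A configuration is a map $\mathcal{C}:V\to\{b,w\}$ (black/white). In $\alpha$-bootstrap percolation ($0<\alpha<1$), starting from $\mathcal{C}_0$, in each round $t\ge1$ all nodes update simultaneously: $\mathcal{C}_t(v)=b$ iff $\mathcal{C}_{t-1}(v)=b$ or the number of neighbors of $v$ that are black in $\mathcal{C}_{t-1}$ is at least $\alpha d(v)$, where $d(v)$ is the degree of $v$; otherwise $\mathcal{C}_t(v)=w$. A set $D\subseteq V$ is a dynamo if for every initial configuration in which all nodes of $D$ are black, eventually all nodes of $V$ are black. $MD_\alpha(G)$ is the minimum size of a dynamo in $\alpha$-bootstrap percolation on $G$.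
   Formalization: The lower bound 1 ≤ MD is stated only for n ≥ 2, because for the one-node graph the node has degree 0, turns black by itself, and MD = 0; the upper bound is stated for all n ≥ 1. *)

theory Defs
  imports Complex_Main "Graph_Theory.Digraph_Component"
begin

text \<open>
  Finite simple undirected graphs are those of the locale \<^locale>\<open>graph\<close>: finite, symmetric
  digraphs without loops and without parallel arcs. Each undirected edge at \<open>v\<close> contributes
  exactly one arc with tail \<open>v\<close>, so \<^const>\<open>out_degree\<close> is the degree of \<open>v\<close>.
\<close>

definition neighbors :: "('a, 'b) pre_digraph \<Rightarrow> 'a \<Rightarrow> 'a set" where
  "neighbors G v = {u. v \<rightarrow>\<^bsub>G\<^esub> u}"

definition min_degree :: "('a, 'b) pre_digraph \<Rightarrow> nat" where
  "min_degree G = Min (out_degree G ` verts G)"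

datatype colour = Black | White

type_synonym 'a configuration = "'a \<Rightarrow> colour"

definition bootstrap_step ::
    "real \<Rightarrow> ('a, 'b) pre_digraph \<Rightarrow> 'a configuration \<Rightarrow> 'a configuration" where
  "bootstrap_step \<alpha> G C v =
    (if C v = Black \<or> real (card {u \<in> neighbors G v. C u = Black}) \<ge> \<alpha> * real (out_degree G v)
     then Black else White)"

fun bootstrap ::
    "real \<Rightarrow> ('a, 'b) pre_digraph \<Rightarrow> 'a configuration \<Rightarrow> nat \<Rightarrow> 'a configuration" where
  "bootstrap \<alpha> G C 0 = C"
| "bootstrap \<alpha> G C (Suc t) = bootstrap_step \<alpha> G (bootstrap \<alpha> G C t)"

text \<open>
  Configurations are total functions on the vertex type, but only their values on
  \<^term>\<open>verts G\<close> influence the process on \<^term>\<open>verts G\<close>.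
\<close>

definition dynamo :: "real \<Rightarrow> ('a, 'b) pre_digraph \<Rightarrow> 'a set \<Rightarrow> bool" where
  "dynamo \<alpha> G D \<longleftrightarrow> D \<subseteq> verts G \<and>
    (\<forall>C. (\<forall>v\<in>D. C v = Black) \<longrightarrow>
      (\<exists>T. \<forall>t\<ge>T. \<forall>v\<in>verts G. bootstrap \<alpha> G C t v = Black))"

definition MD :: "real \<Rightarrow> ('a, 'b) pre_digraph \<Rightarrow> nat" where
  "MD \<alpha> G = Min (card ` {D. dynamo \<alpha> G D})"

text \<open>
  The minimum is attained: on a finite graph the set of sizes of dynamos is finite and,
  as the whole vertex set is a dynamo, nonempty.
\<close>

lemma bootstrap_Black_mono: "C v = Black \<Longrightarrow> bootstrap \<alpha> G C t v = Black"
  by (induction t) (auto simp: bootstrap_step_def)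

lemma dynamo_verts: "dynamo \<alpha> G (verts G)"
  by (auto simp: dynamo_def intro: bootstrap_Black_mono)

lemma MD_attained:
  assumes "finite (verts G)"
  shows "\<exists>D. dynamo \<alpha> G D \<and> card D = MD \<alpha> G"
proof -
  have "{D. dynamo \<alpha> G D} \<subseteq> Pow (verts G)"
    by (auto simp: dynamo_def)
  then have "finite (card ` {D. dynamo \<alpha> G D})"
    using assms by (meson finite_Pow_iff finite_imageI finite_subset)
  moreover have "card ` {D. dynamo \<alpha> G D} \<noteq> {}"
    using dynamo_verts by blast
  ultimately show ?thesis
    unfolding MD_def using Min_in by fastforce
qed

text \<open>
  A vertex of degree \<open>0\<close> turns black unconditionally (\<open>0 \<ge> \<alpha> \<cdot> 0\<close>), so on a one-vertex graph
  the empty set is a dynamo.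
\<close>

lemma MD_single_vertex:
  assumes "verts G = {v}" and "arcs G = {}"
  shows "MD \<alpha> G = 0"
proof -
  have deg: "out_degree G v = 0"
    using assms by (simp add: out_degree_def out_arcs_def)
  have "bootstrap \<alpha> G C t v = Black" if "t \<ge> 1" for C t
    using that by (cases t) (auto simp: bootstrap_step_def deg)
  then have "dynamo \<alpha> G {}"
    unfolding dynamo_def using assms(1) by auto
  moreover have "finite (card ` {D. dynamo \<alpha> G D})"
    by (rule finite_imageI, rule finite_subset[of _ "Pow (verts G)"])
      (auto simp: dynamo_def assms(1))
  ultimately have "MD \<alpha> G \<le> card ({} :: 'a set)"
    unfolding MD_def by (intro Min_le imageI) auto
  then show ?thesis by simp
qed

end

theory Submission
  imports Defs "HOL-Combinatorics.Permutations"
begin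

text \<open>
  Order the vertices by a uniformly random permutation and let \<open>D\<close> consist of the vertices
  \<open>v\<close> preceded by fewer than \<open>\<alpha> d(v)\<close> of their neighbours. Then \<open>D\<close> is a dynamo, since the
  remaining vertices turn black one after another in the given order. The position of \<open>v\<close> within
  its closed neighbourhood is uniform on \<open>d(v) + 1\<close> values, so \<open>v\<close> lies in \<open>D\<close> with probability
  at most \<open>(\<alpha> d(v) + 1) / (d(v) + 1)\<close>, which is at most \<open>(\<alpha> \<delta> + 1) / (\<delta> + 1)\<close>. Hence some
  ordering yields a dynamo of at most the asserted size.
\<close>

section \<open>Ranks within a finite set\<close>

definition rank_in :: "('a \<Rightarrow> nat) \<Rightarrow> 'a set \<Rightarrow> 'a \<Rightarrow> nat" where
  "rank_in f S u = card {w \<in> S. f w < f u}"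

lemma rank_in_strict_mono:
  assumes "finite S" "u \<in> S" "f u < f v"
  shows "rank_in f S u < rank_in f S v"
proof -
  have "{w \<in> S. f w < f u} \<subset> {w \<in> S. f w < f v}"
    using assms by auto
  then show ?thesis
    unfolding rank_in_def using assms(1) by (intro psubset_card_mono) auto
qed

lemma inj_on_rank_in:
  assumes "finite S" "inj_on f S"
  shows "inj_on (rank_in f S) S"
proof (rule inj_onI)
  fix u v assume uv: "u \<in> S" "v \<in> S" "rank_in f S u = rank_in f S v"
  then have "\<not> f u < f v" "\<not> f v < f u"
    using rank_in_strict_mono[OF assms(1), of u f v] rank_in_strict_mono[OF assms(1), of v f u]
    by auto
  then show "u = v"
    using assms(2) uv by (meson inj_onD linorder_less_linear)
qed

text \<open>The ranks in \<open>S\<close> are distinct naturals, and the number of naturals below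
  \<open>x\<close> is \<open>x\<close> rounded up; the rounding costs the extra 1.\<close>

lemma card_rank_in_less:
  assumes "finite S" "inj_on f S" "0 \<le> x"
  shows "real (card {u \<in> S. real (rank_in f S u) < x}) \<le> x + 1"
proof -
  have "rank_in f S ` {u \<in> S. real (rank_in f S u) < x} \<subseteq> {..<nat \<lceil>x\<rceil>}"
  proof clarify
    fix u assume "real (rank_in f S u) < x"
    also have "x \<le> real (nat \<lceil>x\<rceil>)" by (rule real_nat_ceiling_ge)
    finally show "rank_in f S u < nat \<lceil>x\<rceil>" by simp
  qed
  then have "card {u \<in> S. real (rank_in f S u) < x} \<le> nat \<lceil>x\<rceil>"
    using inj_on_rank_in[OF assms(1,2)]
    by (metis (no_types, lifting) card_inj_on_le card_lessThan finite_lessThan inj_on_subset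
        mem_Collect_eq subsetI)
  \<comment> \<open>\<open>0 \<le> x\<close> matters here: \<open>nat\<close> sends negative
    integers to 0, which exceeds \<open>x + 1\<close> once \<open>x < -1\<close>.\<close>
  moreover have "real (nat \<lceil>x\<rceil>) \<le> x + 1"
    using assms(3) by linarith
  ultimately show ?thesis by linarith
qed

section \<open>Symmetry of ranks over all permutations\<close>

text \<open>The transposition maps \<open>S\<close> onto itself and is its own inverse, so it
  carries the elements before \<open>v\<close> in the new order to those before \<open>u\<close> in
  the old one.\<close>

lemma rank_in_comp_transpose:
  assumes "u \<in> S" "v \<in> S"
  shows "rank_in (f \<circ> transpose u v) S v = rank_in f S u"
proof -
  have "bij_betw (transpose u v)
      {w \<in> S. (f \<circ> transpose u v) w < (f \<circ> transpose u v) v} {w \<in> S. f w < f u}"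
    by (rule bij_betw_byWitness[where f' = "transpose u v"])
      (use assms in \<open>auto simp: transpose_def\<close>)
  then show ?thesis
    unfolding rank_in_def by (rule bij_betw_same_card)
qed

text \<open>Composing on the right with the transposition is an involution on the permutations of
  \<open>V\<close> that exchanges the ranks of \<open>u\<close> and \<open>v\<close>.\<close>

lemma card_permutations_rank_in_less_eq:
  assumes "S \<subseteq> V" "u \<in> S" "v \<in> S"
  shows "card {p. p permutes V \<and> real (rank_in (g \<circ> p) S u) < x} =
    card {p. p permutes V \<and> real (rank_in (g \<circ> p) S v) < x}"
proof (rule bij_betw_same_card)
  have tr: "transpose u v permutes V"
    using assms by (intro permutes_swap_id) auto
  have uv: "rank_in (g \<circ> (p \<circ> transpose u v)) S v = rank_in (g \<circ> p) S u"
    and vu: "rank_in (g \<circ> (p \<circ> transpose u v)) S u = rank_in (g \<circ> p) S v" for p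
    using rank_in_comp_transpose[of u S v "g \<circ> p"] rank_in_comp_transpose[of v S u "g \<circ> p"] assms
    by (simp_all add: o_assoc transpose_commute)
  show "bij_betw (\<lambda>p. p \<circ> transpose u v)
      {p. p permutes V \<and> real (rank_in (g \<circ> p) S u) < x}
      {p. p permutes V \<and> real (rank_in (g \<circ> p) S v) < x}"
    by (rule bij_betw_byWitness[where f' = "\<lambda>p. p \<circ> transpose u v"])
      (auto simp: uv vu comp_assoc intro: permutes_compose[OF tr])
qed

text \<open>
  All elements of \<open>S\<close> have the same count by symmetry, and for each single permutation at most
  \<open>x + 1\<close> elements of \<open>S\<close> have rank below \<open>x\<close>.
\<close>

lemma card_permutations_rank_in_less:
  assumes "finite V" "inj_on g V" "S \<subseteq> V" "v \<in> S" "0 \<le> x"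
  shows "real (card S) * real (card {p. p permutes V \<and> real (rank_in (g \<circ> p) S v) < x})
    \<le> (x + 1) * fact (card V)"
proof -
  let ?P = "{p. p permutes V}"
  let ?less = "\<lambda>p u. real (rank_in (g \<circ> p) S u) < x"
  have finS: "finite S" and finP: "finite ?P"
    using assms finite_permutations finite_subset by blast+
  have "real (card S) * real (card {p. p permutes V \<and> ?less p v}) =
      (\<Sum>u\<in>S. real (card {p. p permutes V \<and> ?less p u}))"
    using card_permutations_rank_in_less_eq[OF assms(3) _ assms(4)] by simp
  also have "\<dots> = (\<Sum>u\<in>S. \<Sum>p\<in>?P. of_bool (?less p u))"
    using finP by (simp add: of_bool_def sum.If_cases Int_def)
  also have "\<dots> = (\<Sum>p\<in>?P. \<Sum>u\<in>S. of_bool (?less p u))"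
    by (rule sum.swap)
  also have "\<dots> = (\<Sum>p\<in>?P. real (card {u \<in> S. ?less p u}))"
    using finS by (simp add: of_bool_def sum.If_cases Int_def)
  also have "\<dots> \<le> (\<Sum>p\<in>?P. x + 1)"
  proof (rule sum_mono)
    fix p assume "p \<in> ?P"
    then have "inj_on p S" "p ` S \<subseteq> V"
      using assms(3) by (auto simp: permutes_inj_on permutes_in_image)
    then have "inj_on (g \<circ> p) S"
      using assms(2) by (meson comp_inj_on inj_on_subset)
    then show "real (card {u \<in> S. ?less p u}) \<le> x + 1"
      using card_rank_in_less finS assms(5) by blast
  qed
  also have "\<dots> = (x + 1) * fact (card V)"
    using card_permutations[OF refl assms(1)] by simp
  finally show ?thesis .
qed

section \<open>The dynamo given by a vertex ordering\<close>

definition early :: "real \<Rightarrow> ('a, 'b) pre_digraph \<Rightarrow> ('a \<Rightarrow> nat) \<Rightarrow> 'a set" where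
  "early \<alpha> G f =
    {v \<in> verts G. real (card {w \<in> neighbors G v. f w < f v}) < \<alpha> * real (out_degree G v)}"

context graph
begin

lemma neighbors_subset_verts: "neighbors G v \<subseteq> verts G"
  unfolding neighbors_def using adj_in_verts(2) by blast

lemma finite_neighbors: "finite (neighbors G v)"
  using neighbors_subset_verts finite_verts finite_subset by blast

lemma not_in_neighbors: "v \<notin> neighbors G v"
  unfolding neighbors_def using adj_not_same by blast

lemma card_neighbors: "card (neighbors G v) = out_degree G v"
proof -
  have "neighbors G v = head G ` out_arcs G v"
    by (force simp: neighbors_def arcs_ends_def arc_to_ends_def)
  moreover have "inj_on (head G) (out_arcs G v)"
    using no_multi_arcs by (auto simp: inj_on_def arc_to_ends_def)
  ultimately show ?thesis
    unfolding out_degree_def by (simp add: card_image)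
qed

text \<open>Labels bound waiting times: a vertex outside \<open>early\<close> has at least
  \<open>\<alpha> d(v)\<close> neighbours of smaller label, and these turn black first.\<close>

lemma bootstrap_Black_of_early:
  assumes "\<forall>v\<in>early \<alpha> G f. C v = Black" "v \<in> verts G" "f v < t"
  shows "bootstrap \<alpha> G C t v = Black"
  using assms(2,3)
proof (induction t arbitrary: v)
  case (Suc t)
  show ?case
  proof (cases "v \<in> early \<alpha> G f")
    case True
    then show ?thesis using assms(1) bootstrap_Black_mono by metis
  next
    case False
    \<comment> \<open>From \<open>f w < f v\<close> and \<open>f v < Suc t\<close> follows
      \<open>f w < t\<close>, so the induction hypothesis covers each such neighbour.\<close>
    have "{w \<in> neighbors G v. f w < f v} \<subseteq> {w \<in> neighbors G v. bootstrap \<alpha> G C t w = Black}"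
      using Suc neighbors_subset_verts by fastforce
    then have "card {w \<in> neighbors G v. f w < f v}
        \<le> card {w \<in> neighbors G v. bootstrap \<alpha> G C t w = Black}"
      using finite_neighbors by (intro card_mono) auto
    then show ?thesis
      using False Suc.prems by (auto simp: early_def bootstrap_step_def)
  qed
qed simp

lemma dynamo_early: "dynamo \<alpha> G (early \<alpha> G f)"
  unfolding dynamo_def
proof (intro conjI allI impI)
  show "early \<alpha> G f \<subseteq> verts G"
    by (auto simp: early_def)
  fix C :: "'a configuration" assume "\<forall>v\<in>early \<alpha> G f. C v = Black"
  \<comment> \<open>One round past the largest label serves all vertices at once.\<close>
  then have "bootstrap \<alpha> G C t v = Black"
    if "t \<ge> Suc (Max (f ` verts G))" "v \<in> verts G" for t v
  proof (rule bootstrap_Black_of_early[OF _ that(2)])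
    have "f v \<le> Max (f ` verts G)"
      using that(2) by simp
    then show "f v < t"
      using that(1) by simp
  qed
  then show "\<exists>T. \<forall>t\<ge>T. \<forall>v\<in>verts G. bootstrap \<alpha> G C t v = Black"
    by blast
qed

lemma MD_le_card_dynamo: "dynamo \<alpha> G D \<Longrightarrow> MD \<alpha> G \<le> card D"
  unfolding MD_def
  by (intro Min_le finite_imageI finite_subset[of "{D. dynamo \<alpha> G D}" "Pow (verts G)"])
    (auto simp: dynamo_def)

section \<open>Averaging over all orderings\<close>

lemma card_permutations_early:
  assumes "inj_on g (verts G)" "0 \<le> \<alpha>" "v \<in> verts G"
  shows "real (card {p. p permutes verts G \<and> v \<in> early \<alpha> G (g \<circ> p)})
    \<le> (\<alpha> * real (out_degree G v) + 1) / (real (out_degree G v) + 1) * fact (card (verts G))"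
proof -
  let ?S = "insert v (neighbors G v)"
  \<comment> \<open>\<open>v\<close> never precedes itself, so the count is unchanged on the closed
    neighbourhood, where the symmetry argument applies.\<close>
  have "{w \<in> neighbors G v. f w < f v} = {w \<in> ?S. f w < f v}" for f :: "'a \<Rightarrow> nat"
    by auto
  then have *: "v \<in> early \<alpha> G f \<longleftrightarrow> real (rank_in f ?S v) < \<alpha> * real (out_degree G v)" for f
    using assms(3) by (simp add: early_def rank_in_def)
  have "card ?S = out_degree G v + 1"
    using finite_neighbors not_in_neighbors by (simp add: card_neighbors)
  moreover have "?S \<subseteq> verts G"
    using assms(3) neighbors_subset_verts by auto
  ultimately have "(real (out_degree G v) + 1) *
      real (card {p. p permutes verts G \<and> v \<in> early \<alpha> G (g \<circ> p)})
    \<le> (\<alpha> * real (out_degree G v) + 1) * fact (card (verts G))"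
    using card_permutations_rank_in_less[OF finite_verts assms(1), of ?S v "\<alpha> * real (out_degree G v)"]
      assms(2) by (simp add: * add.commute)
  then show ?thesis
    by (simp add: field_simps)
qed

text \<open>Every ordering gives a dynamo, so \<open>MD\<close> is at most the average size of
  \<open>early\<close> over all permutations; exchanging the sums splits this average by
  vertices.\<close>

lemma MD_le_sum:
  assumes "0 \<le> \<alpha>"
  shows "real (MD \<alpha> G) \<le>
    (\<Sum>v\<in>verts G. (\<alpha> * real (out_degree G v) + 1) / (real (out_degree G v) + 1))"
    (is "_ \<le> sum ?b _")
proof -
  let ?P = "{p. p permutes verts G}"
  \<comment> \<open>\<open>g\<close> is a fixed reference numbering; the labellings
    \<open>g \<circ> p\<close> realise every ordering of the vertices.\<close>
  obtain g :: "'a \<Rightarrow> nat" where g: "inj_on g (verts G)"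
    using finite_imp_inj_to_nat_seg[OF finite_verts] by blast
  have finP: "finite ?P"
    by (simp add: finite_permutations)
  have cardP: "card ?P = fact (card (verts G))"
    by (rule card_permutations) simp_all
  have "fact (card (verts G)) * real (MD \<alpha> G) = (\<Sum>p\<in>?P. real (MD \<alpha> G))"
    using cardP by simp
  also have "\<dots> \<le> (\<Sum>p\<in>?P. real (card (early \<alpha> G (g \<circ> p))))"
    by (intro sum_mono of_nat_mono MD_le_card_dynamo dynamo_early)
  also have "\<dots> = (\<Sum>p\<in>?P. \<Sum>v\<in>verts G. of_bool (v \<in> early \<alpha> G (g \<circ> p)))"
  proof (rule sum.cong)
    fix p
    have "verts G \<inter> {v. v \<in> early \<alpha> G (g \<circ> p)} = early \<alpha> G (g \<circ> p)"
      by (auto simp: early_def)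
    then show "real (card (early \<alpha> G (g \<circ> p))) = (\<Sum>v\<in>verts G. of_bool (v \<in> early \<alpha> G (g \<circ> p)))"
      by (simp add: of_bool_def sum.If_cases)
  qed simp
  also have "\<dots> = (\<Sum>v\<in>verts G. \<Sum>p\<in>?P. of_bool (v \<in> early \<alpha> G (g \<circ> p)))"
    by (rule sum.swap)
  also have "\<dots> = (\<Sum>v\<in>verts G. real (card {p. p permutes verts G \<and> v \<in> early \<alpha> G (g \<circ> p)}))"
    using finP by (simp add: of_bool_def sum.If_cases Int_def)
  also have "\<dots> \<le> (\<Sum>v\<in>verts G. ?b v * fact (card (verts G)))"
    by (intro sum_mono card_permutations_early[OF g assms])
  also have "\<dots> = fact (card (verts G)) * sum ?b (verts G)"
    by (simp only: sum_distrib_left mult.commute)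
  finally show ?thesis
    by simp
qed

text \<open>The summand for degree \<open>d\<close> equals
  \<open>\<alpha> + (1 - \<alpha>) / (d + 1)\<close>, which does not increase with \<open>d\<close>
  when \<open>\<alpha> \<le> 1\<close>.\<close>

lemma MD_le:
  assumes "0 \<le> \<alpha>" "\<alpha> \<le> 1"
  shows "real (MD \<alpha> G) \<le>
    (\<alpha> * real (min_degree G) + 1) / (real (min_degree G) + 1) * real (card (verts G))"
proof -
  have "(\<alpha> * real (out_degree G v) + 1) / (real (out_degree G v) + 1)
      \<le> (\<alpha> * real (min_degree G) + 1) / (real (min_degree G) + 1)" if "v \<in> verts G" for v
  proof -
    have "min_degree G \<le> out_degree G v"
      unfolding min_degree_def using that by simp
    \<comment> \<open>This product is the difference of the two sides after
      cross-multiplication.\<close>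
    then have "0 \<le> (1 - \<alpha>) * (real (out_degree G v) - real (min_degree G))"
      using assms by simp
    then show ?thesis
      by (simp add: divide_simps) (simp add: algebra_simps)
  qed
  then have "(\<Sum>v\<in>verts G. (\<alpha> * real (out_degree G v) + 1) / (real (out_degree G v) + 1))
      \<le> real (card (verts G)) * ((\<alpha> * real (min_degree G) + 1) / (real (min_degree G) + 1))"
    by (rule sum_bounded_above)
  then show ?thesis
    using MD_le_sum[OF assms(1)] by (simp add: mult.commute)
qed

section \<open>The lower bound\<close>

text \<open>With all degrees positive, the all-white configuration never changes on the graph: zero
  black neighbours stay below a positive threshold.\<close>

lemma dynamo_nonempty:
  assumes "0 < \<alpha>" "dynamo \<alpha> G D" "v \<in> verts G" "\<And>u. u \<in> verts G \<Longrightarrow> 0 < out_degree G u"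
  shows "D \<noteq> {}"
proof
  assume "D = {}"
  then obtain t where t: "bootstrap \<alpha> G (\<lambda>_. White) t v = Black"
    using assms(2,3) unfolding dynamo_def by blast
  have "bootstrap \<alpha> G (\<lambda>_. White) t u = White" if "u \<in> verts G" for u
    using that
  proof (induction t arbitrary: u)
    case (Suc t)
    have "{w \<in> neighbors G u. bootstrap \<alpha> G (\<lambda>_. White) t w = Black} = {}"
      using Suc.IH neighbors_subset_verts by fastforce
    then have "card {w \<in> neighbors G u. bootstrap \<alpha> G (\<lambda>_. White) t w = Black} = 0"
      by (simp only: card.empty)
    then show ?case
      using Suc assms(1) assms(4)[of u] unfolding bootstrap.simps bootstrap_step_def
      by (simp add: mult_le_0_iff)
  qed simp
  then show False
    using t assms(3) by simp
qed

text \<open>A path from \<open>u\<close> to a second vertex starts with an arc leaving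
  \<open>u\<close>; symmetry of the arcs turns connectedness into directed reachability.\<close>

lemma connected_out_degree_pos:
  assumes "Digraph_Component.connected G" "2 \<le> card (verts G)" "u \<in> verts G"
  shows "0 < out_degree G u"
proof -
  obtain v where v: "v \<in> verts G" "v \<noteq> u"
    using assms(2,3) by (metis card_1_singleton_iff card_le_Suc0_iff_eq finite_verts
        not_less_eq_eq numeral_2_eq_2)
  have "u \<rightarrow>\<^sup>*\<^bsub>G\<^esub> v"
    using symmetric_connected_imp_strongly_connected[OF sym_arcs assms(1)] assms(3) v(1) by blast
  then obtain w where "u \<rightarrow>\<^bsub>G\<^esub> w"
    using v by (metis converse_reachable_cases)
  then have "neighbors G u \<noteq> {}"
    by (auto simp: neighbors_def)
  then show ?thesis
    using finite_neighbors card_neighbors by (metis card_gt_0_iff)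
qed

end

text \<open>The lower bound asks for two vertices because a single vertex has degree 0 and blackens
  by itself, so that \<open>MD\<close> is 0 there.\<close>

theorem theorem1:
  fixes G :: "('a, 'b) pre_digraph" and \<alpha> :: real and n \<delta> :: nat
  assumes "0 < \<alpha>" and "\<alpha> < 1"
    and "graph G" and "Digraph_Component.connected G"
    and "n = card (verts G)" and "\<delta> = min_degree G"
  shows "(n \<ge> 2 \<longrightarrow> 1 \<le> MD \<alpha> G) \<and>
    real (MD \<alpha> G) \<le> ((real \<delta> + 1 / \<alpha>) / (real \<delta> + 1)) * \<alpha> * real n"
proof (intro conjI impI)
  interpret graph G by fact
  show "1 \<le> MD \<alpha> G" if "n \<ge> 2"
  proof -
    obtain D where D: "dynamo \<alpha> G D" "card D = MD \<alpha> G"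
      using MD_attained[OF finite_verts] by blast
    have "verts G \<noteq> {}"
      using that assms(5) by auto
    then have "D \<noteq> {}"
      using dynamo_nonempty[OF assms(1) D(1)] connected_out_degree_pos[OF assms(4)] that assms(5)
      by blast
    moreover have "finite D"
      using D(1) finite_verts finite_subset unfolding dynamo_def by blast
    ultimately show ?thesis
      using D(2) by (metis One_nat_def Suc_leI card_gt_0_iff)
  qed
  have "(real \<delta> + 1 / \<alpha>) / (real \<delta> + 1) * \<alpha> = (\<alpha> * real \<delta> + 1) / (real \<delta> + 1)"
    using assms(1) by (simp add: distrib_right)
  then show "real (MD \<alpha> G) \<le> ((real \<delta> + 1 / \<alpha>) / (real \<delta> + 1)) * \<alpha> * real n"
    using MD_le[of \<alpha>] assms(1,2,5,6) by simp
qed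

end
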